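(* For every sequence $\mathbf{x}=\{x_k\}_{k\geq 1}$ of points in the unit circle $\mathbb{T}=\mathbb{R}/\mathbb{Z}$, the inequality $D_n(\mathbf{x})\geq \phi_n$ holds for infinitely many integers $n\geq 1$, where $D_n(\mathbf{x})=\max_{t\in\mathbb{T}}\big(\min_{1\leq k\leq n}\rho(t,x_k)\big)$ and $\phi_n=\frac{\ln(n+1)-\ln n}{2\ln 2}$.
   Context: $\mathbb{T}=\mathbb{R}/\mathbb{Z}$ is the unit circle with its standard metric $\rho(s,t)=\mathrm{dist}(s-t,\mathbb{Z})$, i.e. the distance from (any real representative of) $s-t$ to the nearest integer. Sequences are indexed by the integers $k\geq 1$; the terms of the sequence are not assumed to be distinct. *)

theory Defs
  imports "HOL-Analysis.Analysis"
begin

quotient_type circle = real / "\<lambda>s t :: real. s - t \<in> \<int>"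
proof (rule equivpI)
  show "reflp (\<lambda>s t :: real. s - t \<in> \<int>)"
    by (auto intro: reflpI)
  show "symp (\<lambda>s t :: real. s - t \<in> \<int>)"
    by (rule sympI) (metis Ints_minus minus_diff_eq)
  show "transp (\<lambda>s t :: real. s - t \<in> \<int>)"
    by (rule transpI) (metis Ints_add diff_add_cancel add_diff_eq)
qed

lemma infdist_Ints_add:
  fixes r m :: real
  assumes "m \<in> \<int>"
  shows "infdist (r + m) \<int> = infdist r \<int>"
proof -
  have le: "infdist (r + m) \<int> \<le> infdist r \<int>" if "m \<in> \<int>" for r m :: real
  proof -
    have "infdist (r + m) \<int> \<le> dist r z" if z: "z \<in> \<int>" for z
    proof -
      have "z + m \<in> \<int>" using z \<open>m \<in> \<int>\<close> by simp
      then have "infdist (r + m) \<int> \<le> dist (r + m) (z + m)" by (rule infdist_le)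
      then show ?thesis by simp
    qed
    moreover have "(\<int> :: real set) \<noteq> {}" using Ints_0 by blast
    ultimately show ?thesis
      unfolding infdist_notempty[OF \<open>(\<int> :: real set) \<noteq> {}\<close>, of r]
      by (intro cINF_greatest) auto
  qed
  from le[OF assms, of r] le[of "- m" "r + m"] assms show ?thesis by simp
qed

lift_definition rho :: "circle \<Rightarrow> circle \<Rightarrow> real" is "\<lambda>s t. infdist (s - t) \<int>"
proof -
  fix s s' t t' :: real
  assume "s - s' \<in> \<int>" "t - t' \<in> \<int>"
  then have "(s - s') - (t - t') \<in> \<int>" by (rule Ints_diff)
  from infdist_Ints_add[OF this, of "s' - t'"]
  show "infdist (s - t) \<int> = infdist (s' - t') \<int>" by (simp add: algebra_simps)
qed

text \<open>
  For \<open>n \<ge> 1\<close> the supremum is attained (lemma \<open>D_is_maximum\<close>), so it is a maximum.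
\<close>

definition D :: "nat \<Rightarrow> (nat \<Rightarrow> circle) \<Rightarrow> real" where
  "D n x = (SUP t. Min ((\<lambda>k. rho t (x k)) ` {1..n}))"

definition \<phi> :: "nat \<Rightarrow> real" where
  "\<phi> n = (ln (real n + 1) - ln (real n)) / (2 * ln 2)"

lemma continuous_on_Min_image:
  fixes f :: "'i \<Rightarrow> 'a::topological_space \<Rightarrow> real"
  assumes "finite I" "I \<noteq> {}" "\<And>i. i \<in> I \<Longrightarrow> continuous_on S (f i)"
  shows "continuous_on S (\<lambda>u. Min ((\<lambda>i. f i u) ` I))"
  using assms
proof (induction I rule: finite_ne_induct)
  case (singleton i)
  then show ?case by simp
next
  case (insert i I)
  then have "continuous_on S (\<lambda>u. min (f i u) (Min ((\<lambda>i. f i u) ` I)))"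
    by (intro continuous_on_min) auto
  then show ?case using insert.hyps by simp
qed

lemma D_is_maximum:
  assumes "n \<ge> 1"
  shows "\<exists>t. D n x = Min ((\<lambda>k. rho t (x k)) ` {1..n})"
    and "Min ((\<lambda>k. rho t (x k)) ` {1..n}) \<le> D n x"
proof -
  define g where "g t = Min ((\<lambda>k. rho t (x k)) ` {1..n})" for t
  have rho_abs: "rho (abs_circle u) (x k) = infdist (u - rep_circle (x k)) \<int>" for u k
    by (metis Quotient3_circle Quotient3_abs_rep rho.abs_eq)
  have "continuous_on {0..1} (\<lambda>u. g (abs_circle u))"
    unfolding g_def rho_abs using assms
    by (intro continuous_on_Min_image continuous_on_infdist continuous_intros) auto
  then obtain u where u: "\<And>v. v \<in> {0..1} \<Longrightarrow> g (abs_circle v) \<le> g (abs_circle u)"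
    using continuous_attains_sup[of "{0..1::real}" "\<lambda>u. g (abs_circle u)"] by fastforce
  have max: "g t \<le> g (abs_circle u)" for t
  proof -
    obtain r where r: "t = abs_circle r"
      by (metis Quotient3_circle Quotient3_abs_rep)
    have "r - frac r \<in> \<int>" by (simp add: frac_def)
    then have "t = abs_circle (frac r)"
      using r circle.abs_eq_iff by simp
    moreover have "frac r \<in> {0..1}" using frac_lt_1[of r] by simp
    ultimately show ?thesis using u by blast
  qed
  have "D n x = (SUP t. g t)" by (simp add: D_def g_def)
  also have "\<dots> = g (abs_circle u)"
    by (rule cSup_eq_maximum) (use max in auto)
  finally have "D n x = g (abs_circle u)" .
  with max show "\<exists>t. D n x = Min ((\<lambda>k. rho t (x k)) ` {1..n})"
    and "Min ((\<lambda>k. rho t (x k)) ` {1..n}) \<le> D n x"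
    unfolding g_def by auto
qed

end

theory Submission
  imports Defs
begin

text \<open>
  The \<open>n\<close> first points cut the circle into at most \<open>n\<close> arcs. Among any \<open>k + 1\<close> of these arcs, one
  is missed by the \<open>k\<close> points \<open>x\<^sub>n\<^sub>+\<^sub>1, \<dots>, x\<^sub>n\<^sub>+\<^sub>k\<close>, so its length is at most \<open>2 D\<^sub>n\<^sub>+\<^sub>k\<close>.
  Removing such an arc for \<open>k = n - 1, \<dots>, 0\<close> in turn shows that the total length \<open>1\<close> of the
  circle is at most the sum of \<open>2 D\<^sub>n\<^sub>+\<^sub>k\<close> over \<open>k < n\<close>. The corresponding sum of
  \<open>2 \<phi>\<^sub>n\<^sub>+\<^sub>k\<close> telescopes to exactly \<open>1\<close>, so \<open>D\<^sub>m \<ge> \<phi>\<^sub>m\<close> for some \<open>m\<close> with \<open>n \<le> m < 2 n\<close>.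
\<close>

text \<open>Pigeonhole: when \<open>S\<close> has \<open>k + 1\<close> elements, the
  \<open>k\<close> indices below \<open>k\<close> hit at most one element each, so some element is
  unhit and has \<open>len\<close> at most \<open>d k\<close>; removing it leaves the case
  \<open>k\<close>. In the application \<open>S\<close> indexes arcs and \<open>hits j\<close> tells
  which arc the \<open>j\<close>-th new point enters.\<close>

lemma sum_le_sum_lessThan_card_if_unhit_le:
  fixes len :: "'i \<Rightarrow> real" and d :: "nat \<Rightarrow> real" and hits :: "nat \<Rightarrow> 'i \<Rightarrow> bool"
  assumes "finite S"
    and hits_unique: "\<And>j i i'. i \<in> S \<Longrightarrow> i' \<in> S \<Longrightarrow> hits j i \<Longrightarrow> hits j i' \<Longrightarrow> i = i'"
    and unhit: "\<And>i k. i \<in> S \<Longrightarrow> k < card S \<Longrightarrow> (\<And>j. j < k \<Longrightarrow> \<not> hits j i) \<Longrightarrow> len i \<le> d k"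
  shows "sum len S \<le> (\<Sum>k<card S. d k)"
  using assms
proof (induction "card S" arbitrary: S)
  case 0
  then show ?case by simp
next
  case (Suc k)
  have "\<exists>i\<in>S. \<forall>j<k. \<not> hits j i"
  proof (rule ccontr)
    assume "\<not> ?thesis"
    then obtain f where f: "\<And>i. i \<in> S \<Longrightarrow> f i < k \<and> hits (f i) i"
      by metis
    have "inj_on f S"
      using f Suc.prems(2) by (metis inj_onI)
    then have "card S \<le> card {..<k}"
      using f by (intro card_inj_on_le) auto
    with Suc.hyps(2) show False by simp
  qed
  then obtain i where i: "i \<in> S" "\<And>j. j < k \<Longrightarrow> \<not> hits j i"
    by blast
  have k: "card (S - {i}) = k"
    using Suc.hyps(2) Suc.prems(1) i(1) by simp
  have "sum len (S - {i}) \<le> (\<Sum>k<card (S - {i}). d k)"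
  proof (rule Suc.hyps(1))
    show "len i' \<le> d k'"
      if "i' \<in> S - {i}" "k' < card (S - {i})" "\<And>j. j < k' \<Longrightarrow> \<not> hits j i'" for i' k'
      using that k Suc.hyps(2) by (intro Suc.prems(3)) auto
  qed (use k Suc.prems(1,2) in auto)
  moreover have "len i \<le> d k"
    using i Suc.hyps(2) by (intro Suc.prems(3)) auto
  ultimately show ?case
    using k Suc.hyps(2)[symmetric] Suc.prems(1) i(1) by (simp add: sum.remove[of S i])
qed

text \<open>Every representative of \<open>p\<close> lies outside the open interval, hence at least
  half its length away from the midpoint; \<open>rho\<close> is the infimum of these
  distances.\<close>

lemma half_le_rho_if_no_representative_between:
  assumes "a \<le> b" and no_rep: "\<And>u. abs_circle u = p \<Longrightarrow> \<not> (a < u \<and> u < b)"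
  shows "(b - a) / 2 \<le> rho (abs_circle ((a + b) / 2)) p"
proof -
  obtain r where r: "p = abs_circle r"
    by (metis Quotient3_circle Quotient3_abs_rep)
  have "(b - a) / 2 \<le> dist ((a + b) / 2 - r) z" if "z \<in> \<int>" for z
  proof -
    have "abs_circle (r + z) = p"
      using that r circle.abs_eq_iff by simp
    then have "r + z \<le> a \<or> b \<le> r + z"
      using no_rep by force
    then show ?thesis
      using \<open>a \<le> b\<close> by (auto simp: dist_real_def field_simps abs_if)
  qed
  moreover have "(\<int> :: real set) \<noteq> {}"
    using Ints_0 by blast
  ultimately have "(b - a) / 2 \<le> infdist ((a + b) / 2 - r) \<int>"
    unfolding infdist_notempty[OF \<open>(\<int> :: real set) \<noteq> {}\<close>] by (intro cINF_greatest)
  then show ?thesis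
    by (simp add: r rho.abs_eq)
qed

text \<open>The midpoint of the gap serves as test point in the maximum
  \<open>D n x\<close>.\<close>

lemma gap_le_two_D:
  assumes "n \<ge> 1" "a \<le> b"
    and "\<And>k u. 1 \<le> k \<Longrightarrow> k \<le> n \<Longrightarrow> abs_circle u = x k \<Longrightarrow> \<not> (a < u \<and> u < b)"
  shows "b - a \<le> 2 * D n x"
proof -
  have "(b - a) / 2 \<le> rho (abs_circle ((a + b) / 2)) (x k)" if "k \<in> {1..n}" for k
    using assms(2)
    by (rule half_le_rho_if_no_representative_between) (rule assms(3), use that in auto)
  then have "(b - a) / 2 \<le> Min ((\<lambda>k. rho (abs_circle ((a + b) / 2)) (x k)) ` {1..n})"
    using assms(1) by (intro Min.boundedI) auto
  also have "\<dots> \<le> D n x"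
    using assms(1) by (rule D_is_maximum(2))
  finally show ?thesis by simp
qed

lemma D_nonneg: "0 \<le> D n x" if "n \<ge> 1"
  using gap_le_two_D[OF that, of 0 0 x] by simp

lemma abs_circle_inj_on_period:
  assumes "abs_circle u = abs_circle v" "\<bar>u - v\<bar> < 1"
  shows "u = v"
  using assms Ints_eq_abs_less1[of "u - v" 0] by (simp add: circle.abs_eq_iff)

lemma one_le_sum_two_D:
  assumes "n \<ge> 1"
  shows "1 \<le> (\<Sum>k<n. 2 * D (n + k) x)"
proof -
  define y where "y k = frac (rep_circle (x k))" for k
  have abs_y: "abs_circle (y k) = x k" for k
  proof -
    have "abs_circle (y k) = abs_circle (rep_circle (x k))"
      by (simp add: circle.abs_eq_iff y_def frac_def)
    then show ?thesis by (metis Quotient3_circle Quotient3_abs_rep)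
  qed
  define Y where "Y = y ` {1..n}"
  have Y: "finite Y" "Y \<noteq> {}" "card Y \<le> n"
    using assms card_image_le[of "{1..n}" y] by (auto simp: Y_def)
  define m where "m = card Y"
  define c where "c = Min Y"
  have c_in: "c \<in> Y" and c_le: "\<And>v. v \<in> Y \<Longrightarrow> c \<le> v"
    using Y by (auto simp: c_def)
  have lt_c: "v < c + 1" if "v \<in> Y" for v
  proof -
    have "0 \<le> c" "v < 1"
      using c_in that by (auto simp: Y_def y_def frac_lt_1)
    then show ?thesis by simp
  qed
  \<comment> \<open>Cutting the circle at \<open>c\<close> turns its arcs into the gaps between
    neighbours in \<open>l\<close>; \<open>c + 1\<close> represents the same point as
    \<open>c\<close> and closes the last arc.\<close>
  define l where "l = sorted_list_of_set (insert (c + 1) Y)"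
  have set_l: "set l = insert (c + 1) Y" and sorted_l: "sorted l"
    unfolding l_def using Y(1)
    by (simp_all only: set_sorted_list_of_set sorted_sorted_list_of_set finite_insert)
  have len_l: "length l = Suc m"
  proof -
    have "c + 1 \<notin> Y"
      using lt_c by blast
    then show ?thesis
      unfolding l_def m_def length_sorted_list_of_set using Y(1) by simp
  qed
  have mono: "l ! i \<le> l ! j" if "i \<le> j" "j \<le> m" for i j
    using that sorted_l len_l by (simp add: sorted_nth_mono)
  have bounds: "c \<le> l ! i" "l ! i \<le> c + 1" if "i \<le> m" for i
  proof -
    have "l ! i \<in> insert (c + 1) Y"
      using that len_l set_l nth_mem[of i l] by simp
    then show "c \<le> l ! i" "l ! i \<le> c + 1"
      using c_le lt_c by (auto intro: less_imp_le)
  qed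
  have l_0: "l ! 0 = c"
  proof -
    obtain i where "i < length l" "l ! i = c"
      using c_in set_l by (metis in_set_conv_nth insertI2)
    then show ?thesis
      using mono[of 0 i] bounds(1)[of 0] len_l by simp
  qed
  have l_m: "l ! m = c + 1"
  proof -
    obtain i where "i < length l" "l ! i = c + 1"
      using set_l by (metis in_set_conv_nth insertI1)
    then show ?thesis
      using mono[of i m] bounds(2)[of m] len_l by simp
  qed
  \<comment> \<open>The arcs are open: a point landing on an endpoint hits none.\<close>
  define hits where
    "hits k i \<longleftrightarrow> (\<exists>u. abs_circle u = x k \<and> l ! i < u \<and> u < l ! Suc i)" for k i
  have hits_unique: "i = i'" if "hits k i" "hits k i'" "i < m" "i' < m" for k i i'
  proof -
    obtain u u' where u: "abs_circle u = x k" "l ! i < u" "u < l ! Suc i"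
      and u': "abs_circle u' = x k" "l ! i' < u'" "u' < l ! Suc i'"
      using \<open>hits k i\<close> \<open>hits k i'\<close> unfolding hits_def by blast
    \<comment> \<open>Both lie strictly between \<open>c\<close> and \<open>c + 1\<close>, and
      representatives less than 1 apart coincide.\<close>
    have "u = u'"
      using u u' that(3,4) bounds(1)[of i] bounds(1)[of i'] bounds(2)[of "Suc i"]
        bounds(2)[of "Suc i'"]
      by (intro abs_circle_inj_on_period) auto
    then show ?thesis
      using u u' that(3,4) mono[of "Suc i" i'] mono[of "Suc i'" i]
      by (cases i i' rule: linorder_cases) auto
  qed
  have initial: "\<not> hits k i" if "1 \<le> k" "k \<le> n" "i < m" for k i
  proof
    assume "hits k i"
    then obtain u where u: "abs_circle u = x k" "l ! i < u" "u < l ! Suc i"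
      by (auto simp: hits_def)
    have yk: "y k \<in> Y"
      using that by (auto simp: Y_def)
    \<comment> \<open>Again both lie in one period starting at \<open>c\<close>. But
      \<open>y k\<close> is an entry of \<open>l\<close>, so it cannot lie strictly between
      neighbours.\<close>
    have "u = y k"
      using u abs_y[of k] that c_le[OF yk] lt_c[OF yk] bounds(1)[of i] bounds(2)[of "Suc i"]
      by (intro abs_circle_inj_on_period) auto
    moreover obtain j where "j < length l" "l ! j = y k"
      using yk set_l by (metis in_set_conv_nth insertI2)
    ultimately show False
      using u mono[of j i] mono[of "Suc i" j] that(3) len_l by (cases "j \<le> i") auto
  qed
  have "1 = (\<Sum>i<m. l ! Suc i - l ! i)"
    using l_0 l_m by (simp add: sum_lessThan_telescope)
  also have "\<dots> \<le> (\<Sum>k<card {..<m}. 2 * D (n + k) x)"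
  \<comment> \<open>The shift by \<open>Suc\<close> makes index 0 stand for the first new point
    \<open>x (n + 1)\<close>.\<close>
  proof (rule sum_le_sum_lessThan_card_if_unhit_le[where hits = "\<lambda>j. hits (n + Suc j)"])
    fix i k
    assume i: "i \<in> {..<m}" and new: "\<And>j. j < k \<Longrightarrow> \<not> hits (n + Suc j) i"
    have "\<not> hits j i" if "1 \<le> j" "j \<le> n + k" for j
    proof (cases "j \<le> n")
      case True
      then show ?thesis using initial that i by simp
    next
      case False
      then show ?thesis
        using new[of "j - Suc n"] that by simp
    qed
    then show "l ! Suc i - l ! i \<le> 2 * D (n + k) x"
      using assms i mono[of i "Suc i"] by (intro gap_le_two_D) (auto simp: hits_def)
  qed (use hits_unique in auto)
  \<comment> \<open>Coinciding points can make \<open>m\<close> smaller than \<open>n\<close>; the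
    added terms are nonnegative.\<close>
  also have "\<dots> \<le> (\<Sum>k<n. 2 * D (n + k) x)"
    using Y(3) assms D_nonneg by (intro sum_mono2) (auto simp: m_def)
  finally show ?thesis .
qed

lemma sum_two_phi:
  assumes "n \<ge> 1"
  shows "(\<Sum>k<n. 2 * \<phi> (n + k)) = 1"
proof -
  have "(\<Sum>k<n. 2 * \<phi> (n + k)) = (\<Sum>k<n. ln (real (n + Suc k)) - ln (real (n + k))) / ln 2"
    unfolding sum_divide_distrib
    by (rule sum.cong) (simp_all add: \<phi>_def add_ac field_simps)
  also have "\<dots> = (ln (real (n + n)) - ln (real n)) / ln 2"
    by (subst sum_lessThan_telescope[where f = "\<lambda>k. ln (real (n + k))"]) simp
  \<comment> \<open>Doubling \<open>n\<close> contributes exactly the \<open>ln 2\<close> by which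
    \<open>\<phi>\<close> is normalized.\<close>
  also have "ln (real (n + n)) = ln 2 + ln (real n)"
    using assms by (simp add: ln_mult flip: mult_2)
  finally show ?thesis by simp
qed

theorem theorem1:
  fixes x :: "nat \<Rightarrow> circle"
  shows "infinite {n :: nat. n \<ge> 1 \<and> D n x \<ge> \<phi> n}"
  unfolding infinite_nat_iff_unbounded_le
proof
  fix N :: nat
  \<comment> \<open>The successor ensures \<open>n \<ge> 1\<close>, so the sums below are
    nonempty.\<close>
  define n where "n = Suc N"
  have "\<exists>k<n. \<phi> (n + k) \<le> D (n + k) x"
  proof (rule ccontr)
    assume "\<not> ?thesis"
    then have "(\<Sum>k<n. 2 * D (n + k) x) < (\<Sum>k<n. 2 * \<phi> (n + k))"
      by (intro sum_strict_mono) (auto simp: n_def not_le)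
    then show False
      using one_le_sum_two_D[of n x] sum_two_phi[of n] by (simp add: n_def)
  qed
  then obtain k where "\<phi> (n + k) \<le> D (n + k) x"
    by blast
  then show "\<exists>m\<ge>N. m \<in> {n. n \<ge> 1 \<and> D n x \<ge> \<phi> n}"
    by (intro exI[of _ "n + k"]) (simp add: n_def)
qed

end
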